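(* There exist an integer $n\ge 2$, an elliptic curve $E$ given by a Weierstrass equation $Y^2+a_1XY+a_3Y=X^3+a_2X^2+a_4X+a_6$ over a field $K$, and points $P_1,\dots,P_n\in E(K)$ forming a simultaneous arithmetic progression of length $n$ on this equation, such that no $n-1$ of the points $P_1,\dots,P_n$ form a simultaneous arithmetic progression of length $n-1$ on this equation.
   Context: Points $P_1=(x_1,y_1),\dots,P_m=(x_m,y_m)$ on a given Weierstrass equation form a simultaneous arithmetic progression (s.a.p.) of length $m$ if (a) the $x$-coordinates, in the given order, form an arithmetic progression with nonzero common difference, and (b) there is a permutation $\sigma$ of $\{1,\dots,m\}$ such that $y_{\sigma(1)},\dots,y_{\sigma(m)}$ is an arithmetic progression. A set of $m$ points forms a s.a.p. if some ordering of it does. *)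

theory Defs
  imports "HOL-Algebra.Ring" "HOL-Combinatorics.Permutations"
begin

(* Coefficients of y^2 + a1 x y + a3 y = x^3 + a2 x^2 + a4 x + a6. *)
record 'a weierstrass =
  wa1 :: 'a
  wa2 :: 'a
  wa3 :: 'a
  wa4 :: 'a
  wa6 :: 'a

definition weierstrass_over :: "('a, 'b) ring_scheme \<Rightarrow> 'a weierstrass \<Rightarrow> bool" where
  "weierstrass_over K W \<longleftrightarrow> {wa1 W, wa2 W, wa3 W, wa4 W, wa6 W} \<subseteq> carrier K"

(* The usual discriminant -b2^2 b8 - 8 b4^3 - 27 b6^2 + 9 b2 b4 b6, valid in every
   characteristic; integer multiples are iterated additions in K. *)
definition weierstrass_disc :: "('a, 'b) ring_scheme \<Rightarrow> 'a weierstrass \<Rightarrow> 'a" where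
  "weierstrass_disc K W =
     (let a1 = wa1 W; a2 = wa2 W; a3 = wa3 W; a4 = wa4 W; a6 = wa6 W;
          b2 = a1 [^]\<^bsub>K\<^esub> (2::nat) \<oplus>\<^bsub>K\<^esub> add_pow K (4::nat) a2;
          b4 = add_pow K (2::nat) a4 \<oplus>\<^bsub>K\<^esub> a1 \<otimes>\<^bsub>K\<^esub> a3;
          b6 = a3 [^]\<^bsub>K\<^esub> (2::nat) \<oplus>\<^bsub>K\<^esub> add_pow K (4::nat) a6;
          b8 = a1 [^]\<^bsub>K\<^esub> (2::nat) \<otimes>\<^bsub>K\<^esub> a6
               \<oplus>\<^bsub>K\<^esub> add_pow K (4::nat) (a2 \<otimes>\<^bsub>K\<^esub> a6)
               \<ominus>\<^bsub>K\<^esub> a1 \<otimes>\<^bsub>K\<^esub> a3 \<otimes>\<^bsub>K\<^esub> a4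
               \<oplus>\<^bsub>K\<^esub> a2 \<otimes>\<^bsub>K\<^esub> a3 [^]\<^bsub>K\<^esub> (2::nat)
               \<ominus>\<^bsub>K\<^esub> a4 [^]\<^bsub>K\<^esub> (2::nat)
      in (\<ominus>\<^bsub>K\<^esub> (b2 [^]\<^bsub>K\<^esub> (2::nat) \<otimes>\<^bsub>K\<^esub> b8))
         \<ominus>\<^bsub>K\<^esub> add_pow K (8::nat) (b4 [^]\<^bsub>K\<^esub> (3::nat))
         \<ominus>\<^bsub>K\<^esub> add_pow K (27::nat) (b6 [^]\<^bsub>K\<^esub> (2::nat))
         \<oplus>\<^bsub>K\<^esub> add_pow K (9::nat) (b2 \<otimes>\<^bsub>K\<^esub> b4 \<otimes>\<^bsub>K\<^esub> b6))"

definition elliptic_curve :: "('a, 'b) ring_scheme \<Rightarrow> 'a weierstrass \<Rightarrow> bool" where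
  "elliptic_curve K W \<longleftrightarrow>
     weierstrass_over K W \<and> weierstrass_disc K W \<noteq> \<zero>\<^bsub>K\<^esub>"

(* The point at infinity has no coordinates, so it cannot occur in a simultaneous
   arithmetic progression and is left out. *)
definition affine_points :: "('a, 'b) ring_scheme \<Rightarrow> 'a weierstrass \<Rightarrow> ('a \<times> 'a) set" where
  "affine_points K W =
     {(x, y). x \<in> carrier K \<and> y \<in> carrier K \<and>
        y [^]\<^bsub>K\<^esub> (2::nat) \<oplus>\<^bsub>K\<^esub> wa1 W \<otimes>\<^bsub>K\<^esub> x \<otimes>\<^bsub>K\<^esub> y \<oplus>\<^bsub>K\<^esub> wa3 W \<otimes>\<^bsub>K\<^esub> y
        = x [^]\<^bsub>K\<^esub> (3::nat) \<oplus>\<^bsub>K\<^esub> wa2 W \<otimes>\<^bsub>K\<^esub> x [^]\<^bsub>K\<^esub> (2::nat)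
          \<oplus>\<^bsub>K\<^esub> wa4 W \<otimes>\<^bsub>K\<^esub> x \<oplus>\<^bsub>K\<^esub> wa6 W}"

definition arith_prog :: "('a, 'b) ring_scheme \<Rightarrow> 'a \<Rightarrow> 'a list \<Rightarrow> bool" where
  "arith_prog K d zs \<longleftrightarrow>
     d \<in> carrier K \<and> set zs \<subseteq> carrier K \<and>
     (\<forall>i. Suc i < length zs \<longrightarrow> zs ! Suc i = zs ! i \<oplus>\<^bsub>K\<^esub> d)"

(* The difference of the y-coordinates, unlike that of the x-coordinates, may be zero. *)
definition sap :: "('a, 'b) ring_scheme \<Rightarrow> 'a weierstrass \<Rightarrow> ('a \<times> 'a) list \<Rightarrow> bool" where
  "sap K W P \<longleftrightarrow>
     set P \<subseteq> affine_points K W \<and>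
     (\<exists>d. d \<noteq> \<zero>\<^bsub>K\<^esub> \<and> arith_prog K d (map fst P)) \<and>
     (\<exists>\<sigma>. \<sigma> permutes {..<length P} \<and>
        (\<exists>d. arith_prog K d (permute_list \<sigma> (map snd P))))"

definition sap_set :: "('a, 'b) ring_scheme \<Rightarrow> 'a weierstrass \<Rightarrow> ('a \<times> 'a) set \<Rightarrow> bool" where
  "sap_set K W S \<longleftrightarrow> (\<exists>P. distinct P \<and> set P = S \<and> sap K W P)"

(* A carrier type for existential quantification over fields. The finitely many
   coefficients and coordinates of a configuration over any field generate a countable
   subfield, which has an isomorphic copy whose carrier is a set of integers (with
   arbitrary field operations, unrelated to those of the integers). Hence restricting
   to this type loses no field and, in particular, no characteristic. *)
type_synonym small_field = "int ring"

end

theory Submission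
  imports Defs "HOL-Number_Theory.Residues"
begin

text \<open>
  In characteristic 3 any arithmetic progression of length 3 sums to zero, so a simultaneous
  arithmetic progression of length 3 has coordinate sum \<open>(0, 0)\<close>. On the curve
  \<open>y\<^sup>2 + x y = x\<^sup>3 + 2 x\<^sup>2 + 2 x + 1\<close> over \<open>\<int>/3\<int>\<close> the points
  \<open>(0, 1), (1, 0), (2, 0), (0, 2)\<close> are a progression of length 4, which wraps around modulo 3,
  with coordinate sum \<open>(0, 0)\<close>. Dropping a point changes this sum, since \<open>(0, 0)\<close> is not among
  them.
\<close>

interpretation F3: residues_prime 3 "residue_ring 3"
  by unfold_locales simp_all

text \<open>Modulo 3 the entries are \<open>a\<close>, \<open>a + d\<close>,
  \<open>a + 2 * d\<close>, with sum \<open>3 * (a + d)\<close>.\<close>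

lemma sum_list_arith_prog_3:
  assumes "arith_prog (residue_ring 3) d zs" and "length zs = 3"
  shows "3 dvd sum_list zs"
proof -
  obtain a b c where zs: "zs = [a, b, c]"
    using \<open>length zs = 3\<close> by (auto simp: numeral_3_eq_3 length_Suc_conv)
  have "zs ! Suc i = (zs ! i + d) mod 3" if "Suc i < 3" for i
    using assms that by (simp add: arith_prog_def F3.res_add_eq)
  from this[of 0] this[of 1] show ?thesis
    by (simp add: zs) presburger
qed

text \<open>A sum ignores the order of its terms, so neither the ordering of the points nor the
  permutation of the y-coordinates affects it.\<close>

lemma sap_set_3_coordinate_sums:
  assumes "sap_set (residue_ring 3) W T" and "card T = 3"
  shows "3 dvd (\<Sum>p\<in>T. fst p)" and "3 dvd (\<Sum>p\<in>T. snd p)"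
proof -
  obtain P where P: "distinct P" "set P = T" "sap (residue_ring 3) W P"
    using assms(1) by (auto simp: sap_set_def)
  have len: "length P = 3"
    using P assms(2) distinct_card by force
  have sums: "(\<Sum>p\<in>T. f p) = sum_list (map f P)" for f :: "int \<times> int \<Rightarrow> int"
    using P by (simp add: sum_list_distinct_conv_sum_set)
  show "3 dvd (\<Sum>p\<in>T. fst p)"
    using P(3) len unfolding sums sap_def by (auto intro: sum_list_arith_prog_3)
  obtain \<sigma> d where \<sigma>: "\<sigma> permutes {..<length P}"
    and "arith_prog (residue_ring 3) d (permute_list \<sigma> (map snd P))"
    using P(3) by (auto simp: sap_def)
  then have "3 dvd sum_list (permute_list \<sigma> (map snd P))"
    using len by (intro sum_list_arith_prog_3) auto
  moreover have "sum_list (permute_list \<sigma> (map snd P)) = sum_list (map snd P)"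
    using \<sigma> by (metis length_map mset_permute_list sum_mset_sum_list)
  ultimately show "3 dvd (\<Sum>p\<in>T. snd p)"
    by (simp add: sums)
qed

definition wrap_curve :: "int weierstrass" where
  "wrap_curve = \<lparr>wa1 = 1, wa2 = 2, wa3 = 0, wa4 = 2, wa6 = 1\<rparr>"

definition wrap_points :: "(int \<times> int) list" where
  "wrap_points = [(0, 1), (1, 0), (2, 0), (0, 2)]"

lemma add_pow_residue_ring_3:
  "add_pow (residue_ring 3) (n::nat) a = (int n * a) mod 3"
  by (induction n)
     (simp_all add: add_pow_def nat_pow_def F3.res_zero_eq F3.res_add_eq mod_simps algebra_simps)

lemma pow_residue_ring_3:
  "a [^]\<^bsub>residue_ring 3\<^esub> (n::nat) = (a ^ n) mod 3"
  by (induction n)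
     (simp_all add: nat_pow_def F3.res_one_eq F3.res_mult_eq mod_simps mult.commute)

lemma elliptic_curve_wrap_curve: "elliptic_curve (residue_ring 3) wrap_curve"
proof -
  \<comment> \<open>Modulo 3, \<open>b2\<close> vanishes and \<open>b4\<close> is 1, so only
    \<open>- 8 * b4 ^ 3\<close> survives, which is 1.\<close>
  have "weierstrass_disc (residue_ring 3) wrap_curve = 1"
    unfolding weierstrass_disc_def wrap_curve_def Let_def weierstrass.simps a_minus_def
      add_pow_residue_ring_3 pow_residue_ring_3 F3.res_add_eq F3.res_mult_eq F3.res_neg_eq
    by simp
  then show ?thesis
    by (simp add: elliptic_curve_def weierstrass_over_def wrap_curve_def
        F3.res_carrier_eq F3.res_zero_eq)
qed

lemma sap_wrap_points: "sap (residue_ring 3) wrap_curve wrap_points"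
proof -
  \<comment> \<open>The y-coordinates are 1, 0, 0, 2 in order; swapping within the first and the
    last pair gives 0, 1, 2, 0, with difference 1 modulo 3.\<close>
  let ?\<sigma> = "transpose 0 1 \<circ> transpose 2 (3::nat)"
  have "set wrap_points \<subseteq> affine_points (residue_ring 3) wrap_curve"
    by (simp add: wrap_points_def wrap_curve_def affine_points_def F3.res_carrier_eq
        F3.res_add_eq F3.res_mult_eq pow_residue_ring_3)
  moreover have "arith_prog (residue_ring 3) 1 (map fst wrap_points)"
    by (auto simp: arith_prog_def wrap_points_def F3.res_carrier_eq F3.res_add_eq
        less_Suc_eq numeral_eq_Suc)
  moreover have "?\<sigma> permutes {..<length wrap_points}"
    by (intro permutes_compose permutes_swap_id) (simp_all add: wrap_points_def)
  moreover have "permute_list ?\<sigma> (map snd wrap_points) = [0, 1, 2, 0]"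
    by (simp add: permute_list_def wrap_points_def transpose_def upt_rec)
  moreover have "arith_prog (residue_ring 3) 1 [0, 1, 2, 0]"
    by (auto simp: arith_prog_def F3.res_carrier_eq F3.res_add_eq less_Suc_eq numeral_eq_Suc)
  ultimately show ?thesis
    unfolding sap_def by (metis F3.one_not_zero F3.res_one_eq)
qed

text \<open>The obstruction lies in the coordinate sums alone, so \<open>W\<close> can be
  arbitrary.\<close>

lemma not_sap_set_subset_wrap_points:
  assumes "T \<subseteq> set wrap_points" and "card T = 3"
  shows "\<not> sap_set (residue_ring 3) W T"
proof
  assume "sap_set (residue_ring 3) W T"
  note dvd = sap_set_3_coordinate_sums[OF this assms(2)]
  have "card (set wrap_points - T) = 1"
    using assms by (simp add: card_Diff_subset finite_subset) (simp add: wrap_points_def)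
  then obtain p where "set wrap_points - T = {p}"
    by (auto simp: card_1_singleton_iff)
  then have p: "p \<in> set wrap_points" and T: "T = set wrap_points - {p}"
    using assms(1) by auto
  have "(\<Sum>q\<in>set wrap_points. f q) = f p + (\<Sum>q\<in>T. f q)" for f :: "int \<times> int \<Rightarrow> int"
    unfolding T using p by (intro sum.remove) auto
  \<comment> \<open>As integers, the coordinates of all four points add up to 0 + 1 + 2 + 0 and 1 +
    0 + 0 + 2.\<close>
  from this[of fst] this[of snd]
  have "fst p + (\<Sum>q\<in>T. fst q) = 3" "snd p + (\<Sum>q\<in>T. snd q) = 3"
    by (simp_all add: wrap_points_def)
  with dvd have "3 dvd fst p" "3 dvd snd p"
    by presburger+
  \<comment> \<open>Coordinates lie between 0 and 2, so \<open>p\<close> would have to be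
    \<open>(0, 0)\<close>.\<close>
  then show False
    using p by (auto simp: wrap_points_def)
qed

theorem theorem2:
  "\<exists>(n :: nat) (K :: small_field) W P.
     n \<ge> 2 \<and> field K \<and> elliptic_curve K W \<and>
     length P = n \<and> distinct P \<and> sap K W P \<and>
     (\<forall>T \<subseteq> set P. card T = n - 1 \<longrightarrow> \<not> sap_set K W T)"
proof (intro exI conjI)
  show "field (residue_ring 3)"
    by (fact F3.is_field)
  show "length wrap_points = 4" "distinct wrap_points"
    by (simp_all add: wrap_points_def)
  show "\<forall>T \<subseteq> set wrap_points. card T = 4 - 1 \<longrightarrow> \<not> sap_set (residue_ring 3) wrap_curve T"
    by (simp add: not_sap_set_subset_wrap_points)
qed (simp_all add: elliptic_curve_wrap_curve sap_wrap_points)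

end
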